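(* Let $m\ge 1$ and let $b\in P_m$ be any pure $m$-braid, with (unreduced) Burau matrix $f(b)=[f_{ij}(b;t)]$ and crossing matrix $C(b)=[c_{ij}]$. Then $$c_{ij}=\begin{cases}0 & \text{if } i=j,\\ \left.-\dfrac{d}{dt}f_{ij}(b;t)\right|_{t=1} & \text{if } i\ne j.\end{cases}$$
   Context: $B_m$ is the braid group with Artin generators $\sigma_1,\dots,\sigma_{m-1}$ and relations $\sigma_i\sigma_{i+1}\sigma_i=\sigma_{i+1}\sigma_i\sigma_{i+1}$ ($1\le i\le m-2$), $\sigma_i\sigma_j=\sigma_j\sigma_i$ ($|i-j|>1$). A word in the $\sigma_i^{\pm1}$ is read from left to right as a braid diagram from top to bottom. The $i$th strand of a braid is the strand whose upper endpoint is in the $i$th position from the left. A pure braid is a braid whose induced permutation of $\{1,\dots,m\}$ (sending the upper position of each strand to its lower position) is the identity; $P_m\subset B_m$ is the subgroup of pure braids, i.e. the kernel of $B_m\to S_m$, $\sigma_i\mapsto (i\ i+1)$. Burau matrix: let $\Lambda=\mathbb{Z}[t,t^{-1}]$. The (unreduced) Burau representation is the group homomorphism $f:B_m\to GL_m(\Lambda)$ with $$f(\sigma_i)=I_{i-1}\oplus\begin{bmatrix}1-t&1\\ t&0\end{bmatrix}\oplus I_{m-i-1}\quad(1\le i\le m-1).$$ Crossing matrix: for a diagram (word) $\beta$ of $b\in B_m$, a crossing coming from a letter $\sigma_k$ is positive and one coming from $\sigma_k^{-1}$ is negative. At a letter $\sigma_k$ the strand moving from position $k+1$ to position $k$ passes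 over the strand moving from position $k$ to position $k+1$; at a letter $\sigma_k^{-1}$ the strand moving from position $k$ to position $k+1$ passes over the other. The crossing matrix $C(b)\in M_m(\mathbb{Z})$ has zero diagonal, and for $i\ne j$ its $(i,j)$ entry is the number of positive crossings minus the number of negative crossings of $\beta$ at which the $i$th strand is over the $j$th strand. It is known that this is independent of the diagram $\beta$ of $b$. *)

theory Defs
  imports
    "HOL-Analysis.Derivative"
    "HOL-Library.Poly_Mapping"
    "HOL-Algebra.Sym_Groups"
    "Jordan_Normal_Form.Matrix"
begin

section \<open>The braid group\<close>

text \<open>The letter \<open>(k, True)\<close> stands for the Artin generator of index \<open>k\<close> and \<open>(k, False)\<close> for its
  inverse; generators of the braid group on \<open>m\<close> strands have indices \<open>1, \<dots>, m - 1\<close>. Words are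
  read from left to right as diagrams from top to bottom.\<close>

type_synonym braid_word = "(nat \<times> bool) list"

definition braid_words :: "nat \<Rightarrow> braid_word set" where
  "braid_words m = lists ({1..<m} \<times> UNIV)"

inductive braid_equiv :: "nat \<Rightarrow> braid_word \<Rightarrow> braid_word \<Rightarrow> bool" for m where
  be_refl: "w \<in> braid_words m \<Longrightarrow> braid_equiv m w w"
| be_sym: "braid_equiv m u v \<Longrightarrow> braid_equiv m v u"
| be_trans: "braid_equiv m u v \<Longrightarrow> braid_equiv m v w \<Longrightarrow> braid_equiv m u w"
| be_append: "braid_equiv m u v \<Longrightarrow> braid_equiv m u' v' \<Longrightarrow> braid_equiv m (u @ u') (v @ v')"
| be_cancel: "k \<in> {1..<m} \<Longrightarrow> braid_equiv m [(k, s), (k, \<not> s)] []"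
| be_braid: "k \<in> {1..<m} \<Longrightarrow> Suc k \<in> {1..<m} \<Longrightarrow>
    braid_equiv m [(k, True), (Suc k, True), (k, True)] [(Suc k, True), (k, True), (Suc k, True)]"
| be_far: "i \<in> {1..<m} \<Longrightarrow> j \<in> {1..<m} \<Longrightarrow> Suc i < j \<Longrightarrow>
    braid_equiv m [(i, True), (j, True)] [(j, True), (i, True)]"

definition braid_rel :: "nat \<Rightarrow> (braid_word \<times> braid_word) set" where
  "braid_rel m = {(u, v). braid_equiv m u v}"

definition braid_group :: "nat \<Rightarrow> braid_word set monoid" where
  "braid_group m =
    \<lparr>carrier = braid_words m // braid_rel m,
     mult = (\<lambda>a b. \<Union>u\<in>a. \<Union>v\<in>b. braid_rel m `` {u @ v}),
     one = braid_rel m `` {[]}\<rparr>"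

definition braid_gen :: "nat \<Rightarrow> nat \<Rightarrow> braid_word set" where
  "braid_gen m k = braid_rel m `` {[(k, True)]}"

text \<open>The homomorphism to a group \<open>G\<close> extending an assignment \<open>g\<close> of elements of \<open>G\<close> to the
  generators. It is the common value of \<open>word_val G g\<close> on all words representing a braid
  whenever \<open>g\<close> satisfies the defining relations (see \<open>braid_lift_hom\<close>).\<close>

definition word_val :: "('a, 'b) monoid_scheme \<Rightarrow> (nat \<Rightarrow> 'a) \<Rightarrow> braid_word \<Rightarrow> 'a" where
  "word_val G g w = foldr (\<lambda>(k, s) x. (if s then g k else inv\<^bsub>G\<^esub> (g k)) \<otimes>\<^bsub>G\<^esub> x) w \<one>\<^bsub>G\<^esub>"

definition braid_lift ::
  "('a, 'b) monoid_scheme \<Rightarrow> (nat \<Rightarrow> 'a) \<Rightarrow> braid_word set \<Rightarrow> 'a" where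
  "braid_lift G g b = the_elem (word_val G g ` b)"

lemma braid_equiv_words: "braid_equiv m u v \<Longrightarrow> u \<in> braid_words m \<and> v \<in> braid_words m"
  by (induction rule: braid_equiv.induct) (auto simp: braid_words_def)

lemma equiv_braid_rel: "equiv (braid_words m) (braid_rel m)"
  unfolding braid_rel_def
  by (rule equivI)
    (auto simp: refl_on_def sym_def trans_def dest: braid_equiv_words
      intro: braid_equiv.be_refl braid_equiv.be_sym braid_equiv.be_trans)

lemma braid_group_carrierE:
  assumes "b \<in> carrier (braid_group m)"
  obtains w where "w \<in> braid_words m" "b = braid_rel m `` {w}"
  using assms by (auto simp: braid_group_def quotient_def)

lemma braid_class_carrier: "w \<in> braid_words m \<Longrightarrow> braid_rel m `` {w} \<in> carrier (braid_group m)"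
  by (auto simp: braid_group_def quotient_def)

lemma braid_class_eq_iff:
  "u \<in> braid_words m \<Longrightarrow> v \<in> braid_words m \<Longrightarrow>
    braid_rel m `` {u} = braid_rel m `` {v} \<longleftrightarrow> braid_equiv m u v"
  using eq_equiv_class_iff[OF equiv_braid_rel] by (simp add: braid_rel_def)

lemma braid_group_mult_class:
  assumes "u \<in> braid_words m" "v \<in> braid_words m"
  shows "(braid_rel m `` {u}) \<otimes>\<^bsub>braid_group m\<^esub> (braid_rel m `` {v}) = braid_rel m `` {u @ v}"
proof -
  have *: "braid_rel m `` {x @ y} = braid_rel m `` {u @ v}"
    if "x \<in> braid_rel m `` {u}" "y \<in> braid_rel m `` {v}" for x y
    using that braid_equiv.be_append[of m u x v y] equiv_class_eq[OF equiv_braid_rel]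
    by (fastforce simp: braid_rel_def)
  have uv: "u \<in> braid_rel m `` {u}" "v \<in> braid_rel m `` {v}"
    using assms by (auto simp: braid_rel_def intro: braid_equiv.be_refl)
  have "(\<Union>x\<in>braid_rel m `` {u}. \<Union>y\<in>braid_rel m `` {v}. braid_rel m `` {x @ y}) =
      (\<Union>x\<in>braid_rel m `` {u}. \<Union>y\<in>braid_rel m `` {v}. braid_rel m `` {u @ v})"
    by (intro SUP_cong refl *)
  also have "\<dots> = braid_rel m `` {u @ v}"
    using uv by blast
  finally show ?thesis by (simp add: braid_group_def)
qed

definition inv_word :: "braid_word \<Rightarrow> braid_word" where
  "inv_word w = rev (map (\<lambda>(k, s). (k, \<not> s)) w)"

lemma inv_word_words: "w \<in> braid_words m \<Longrightarrow> inv_word w \<in> braid_words m"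
  by (force simp: inv_word_def braid_words_def)

lemma inv_word_equiv: "w \<in> braid_words m \<Longrightarrow> braid_equiv m (inv_word w @ w) []"
proof (induction w)
  case Nil
  then show ?case by (auto simp: inv_word_def intro: braid_equiv.be_refl)
next
  case (Cons x w)
  obtain k s where x: "x = (k, s)" by force
  have w: "w \<in> braid_words m" and k: "k \<in> {1..<m}"
    using Cons.prems by (auto simp: braid_words_def x)
  have "braid_equiv m (inv_word w @ [(k, \<not> s), (k, \<not> \<not> s)] @ w) (inv_word w @ [] @ w)"
    using w k
    by (intro braid_equiv.be_append braid_equiv.be_refl braid_equiv.be_cancel inv_word_words)
  then show ?case
    using Cons.IH[OF w] by (auto simp: x inv_word_def intro: braid_equiv.be_trans)
qed

lemma group_braid_group: "group (braid_group m)"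
proof (rule groupI)
  fix x y assume "x \<in> carrier (braid_group m)" "y \<in> carrier (braid_group m)"
  then show "x \<otimes>\<^bsub>braid_group m\<^esub> y \<in> carrier (braid_group m)"
    by (elim braid_group_carrierE)
      (auto simp: braid_group_mult_class braid_words_def intro!: braid_class_carrier)
next
  have "[] \<in> braid_words m" by (simp add: braid_words_def)
  then show "\<one>\<^bsub>braid_group m\<^esub> \<in> carrier (braid_group m)"
    using braid_class_carrier by (simp add: braid_group_def)
next
  fix x y z
  assume "x \<in> carrier (braid_group m)" "y \<in> carrier (braid_group m)" "z \<in> carrier (braid_group m)"
  then obtain u v w where
    "u \<in> braid_words m" "x = braid_rel m `` {u}"
    "v \<in> braid_words m" "y = braid_rel m `` {v}"
    "w \<in> braid_words m" "z = braid_rel m `` {w}"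
    by (metis braid_group_carrierE)
  moreover from this have "u @ v \<in> braid_words m" "v @ w \<in> braid_words m"
    by (auto simp: braid_words_def)
  ultimately show "x \<otimes>\<^bsub>braid_group m\<^esub> y \<otimes>\<^bsub>braid_group m\<^esub> z =
      x \<otimes>\<^bsub>braid_group m\<^esub> (y \<otimes>\<^bsub>braid_group m\<^esub> z)"
    by (simp add: braid_group_mult_class)
next
  fix x assume "x \<in> carrier (braid_group m)"
  then obtain w where w: "w \<in> braid_words m" "x = braid_rel m `` {w}"
    by (rule braid_group_carrierE)
  have nil: "[] \<in> braid_words m" by (simp add: braid_words_def)
  have one: "\<one>\<^bsub>braid_group m\<^esub> = braid_rel m `` {[]}" by (simp add: braid_group_def)
  show "\<one>\<^bsub>braid_group m\<^esub> \<otimes>\<^bsub>braid_group m\<^esub> x = x"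
    unfolding one w(2) using braid_group_mult_class[OF nil w(1)] by simp
  have iw: "inv_word w \<in> braid_words m" using w(1) by (rule inv_word_words)
  have "(braid_rel m `` {inv_word w}) \<otimes>\<^bsub>braid_group m\<^esub> x = \<one>\<^bsub>braid_group m\<^esub>"
    unfolding one w(2) braid_group_mult_class[OF iw w(1)]
    using inv_word_equiv[OF w(1)] equiv_class_eq[OF equiv_braid_rel]
    by (simp add: braid_rel_def)
  then show "\<exists>y\<in>carrier (braid_group m). y \<otimes>\<^bsub>braid_group m\<^esub> x = \<one>\<^bsub>braid_group m\<^esub>"
    using braid_class_carrier[OF iw] by blast
qed

context
  fixes G :: "('a, 'b) monoid_scheme" and g :: "nat \<Rightarrow> 'a" and m :: nat
  assumes G: "group G"
    and closed: "\<And>k. k \<in> {1..<m} \<Longrightarrow> g k \<in> carrier G"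
    and braid_rel: "\<And>k. k \<in> {1..<m} \<Longrightarrow> Suc k \<in> {1..<m} \<Longrightarrow>
      g k \<otimes>\<^bsub>G\<^esub> (g (Suc k) \<otimes>\<^bsub>G\<^esub> g k) = g (Suc k) \<otimes>\<^bsub>G\<^esub> (g k \<otimes>\<^bsub>G\<^esub> g (Suc k))"
    and far_rel: "\<And>i j. i \<in> {1..<m} \<Longrightarrow> j \<in> {1..<m} \<Longrightarrow> Suc i < j \<Longrightarrow>
      g i \<otimes>\<^bsub>G\<^esub> g j = g j \<otimes>\<^bsub>G\<^esub> g i"
begin

interpretation G: group G by (rule G)

lemma word_val_closed: "w \<in> braid_words m \<Longrightarrow> word_val G g w \<in> carrier G"
  by (induction w) (auto simp: word_val_def braid_words_def closed)

lemma word_val_append: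
  "u \<in> braid_words m \<Longrightarrow> v \<in> braid_words m \<Longrightarrow>
    word_val G g (u @ v) = word_val G g u \<otimes>\<^bsub>G\<^esub> word_val G g v"
proof (induction u)
  case Nil
  then show ?case using word_val_closed[of v] by (simp add: word_val_def)
next
  case (Cons x u)
  obtain k s where x: "x = (k, s)" by force
  have u: "u \<in> braid_words m" and k: "g k \<in> carrier G"
    using Cons.prems closed by (auto simp: braid_words_def x)
  show ?case
    using Cons.IH[OF u Cons.prems(2)] k word_val_closed[OF u] word_val_closed[OF Cons.prems(2)]
    by (auto simp: word_val_def x G.m_assoc)
qed

lemma word_val_equiv: "braid_equiv m u v \<Longrightarrow> word_val G g u = word_val G g v"
proof (induction rule: braid_equiv.induct)
  case (be_append u v u' v')
  then show ?case using braid_equiv_words by (metis word_val_append)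
next
  case (be_cancel k s)
  then show ?case using closed[of k] by (cases s) (auto simp: word_val_def)
next
  case (be_braid k)
  then show ?case using closed[of k] closed[of "Suc k"] braid_rel[of k] by (simp add: word_val_def)
next
  case (be_far i j)
  then show ?case using closed[of i] closed[of j] far_rel[of i j] by (simp add: word_val_def)
qed auto

lemma braid_lift_class:
  assumes "w \<in> braid_words m"
  shows "braid_lift G g (braid_rel m `` {w}) = word_val G g w"
proof -
  have "word_val G g ` (braid_rel m `` {w}) = {word_val G g w}"
    using word_val_equiv assms braid_equiv.be_refl by (fastforce simp: braid_rel_def)
  then show ?thesis by (simp add: braid_lift_def)
qed

lemma braid_lift_hom: "braid_lift G g \<in> hom (braid_group m) G"
proof (rule homI)
  fix x assume "x \<in> carrier (braid_group m)"
  then show "braid_lift G g x \<in> carrier G"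
    by (elim braid_group_carrierE) (simp add: braid_lift_class word_val_closed)
next
  fix x y assume "x \<in> carrier (braid_group m)" "y \<in> carrier (braid_group m)"
  then obtain u v where *: "u \<in> braid_words m" "x = braid_rel m `` {u}"
    "v \<in> braid_words m" "y = braid_rel m `` {v}"
    by (metis braid_group_carrierE)
  moreover from this have "u @ v \<in> braid_words m" by (auto simp: braid_words_def)
  ultimately show "braid_lift G g (x \<otimes>\<^bsub>braid_group m\<^esub> y) = braid_lift G g x \<otimes>\<^bsub>G\<^esub> braid_lift G g y"
    by (simp add: braid_group_mult_class braid_lift_class word_val_append)
qed

lemma braid_lift_gen: "k \<in> {1..<m} \<Longrightarrow> braid_lift G g (braid_gen m k) = g k"
  using closed[of k] braid_lift_class[of "[(k, True)]"]
  by (simp add: braid_gen_def braid_words_def word_val_def)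

end


section \<open>Pure braids\<close>

text \<open>Since \<^const>\<open>sym_group\<close> composes from right to left, \<open>braid_perm m b\<close> sends the lower position
  of each strand of \<open>b\<close> to its upper position. It is the inverse of the permutation induced by \<open>b\<close>,
  which does not change the kernel (see \<open>pure_braid_iff\<close>).\<close>

definition braid_perm :: "nat \<Rightarrow> braid_word set \<Rightarrow> nat \<Rightarrow> nat" where
  "braid_perm m = braid_lift (sym_group m) (\<lambda>k. Transposition.transpose k (Suc k))"

definition pure_braids :: "nat \<Rightarrow> braid_word set set" where
  "pure_braids m = kernel (braid_group m) (sym_group m) (braid_perm m)"

lemma transpose_sym_group:
  "k \<in> {1..<m} \<Longrightarrow> Transposition.transpose k (Suc k) \<in> carrier (sym_group m)"
  by (auto simp: sym_group_carrier intro: permutes_swap_id)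

lemma transpose_braid_rel:
  "Transposition.transpose k (Suc k) \<otimes>\<^bsub>sym_group m\<^esub>
     (Transposition.transpose (Suc k) (Suc (Suc k)) \<otimes>\<^bsub>sym_group m\<^esub> Transposition.transpose k (Suc k)) =
   Transposition.transpose (Suc k) (Suc (Suc k)) \<otimes>\<^bsub>sym_group m\<^esub>
     (Transposition.transpose k (Suc k) \<otimes>\<^bsub>sym_group m\<^esub> Transposition.transpose (Suc k) (Suc (Suc k)))"
  by (auto simp: sym_group_mult fun_eq_iff Transposition.transpose_def)

lemma transpose_far_rel:
  "Suc i < j \<Longrightarrow>
   Transposition.transpose i (Suc i) \<otimes>\<^bsub>sym_group m\<^esub> Transposition.transpose j (Suc j) =
   Transposition.transpose j (Suc j) \<otimes>\<^bsub>sym_group m\<^esub> Transposition.transpose i (Suc i)"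
  by (auto simp: sym_group_mult fun_eq_iff Transposition.transpose_def)

lemmas transpose_rels =
  sym_group_is_group transpose_sym_group transpose_braid_rel transpose_far_rel

lemma braid_perm_hom: "braid_perm m \<in> hom (braid_group m) (sym_group m)"
  unfolding braid_perm_def by (rule braid_lift_hom) (use transpose_rels in auto)

lemma braid_perm_gen:
  "k \<in> {1..<m} \<Longrightarrow> braid_perm m (braid_gen m k) = Transposition.transpose k (Suc k)"
  unfolding braid_perm_def by (rule braid_lift_gen) (use transpose_rels in auto)


section \<open>The Burau representation\<close>

text \<open>The Laurent polynomial ring over the integers, as the group ring of the additive group of
  the integers.\<close>

type_synonym laurent = "int \<Rightarrow>\<^sub>0 int"

definition laurent_t :: laurent where
  "laurent_t = Poly_Mapping.single 1 1"

text \<open>Evaluation at a nonzero real number.\<close>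

definition laurent_eval :: "laurent \<Rightarrow> real \<Rightarrow> real" where
  "laurent_eval p x = (\<Sum>k\<in>Poly_Mapping.keys p. of_int (Poly_Mapping.lookup p k) * x powi k)"

lemma laurent_eval_differentiable:
  assumes "x \<noteq> 0"
  shows "laurent_eval p field_differentiable at x"
proof -
  have "(laurent_eval p has_field_derivative
      (\<Sum>k\<in>Poly_Mapping.keys p. of_int (Poly_Mapping.lookup p k) * (of_int k * x powi (k - 1)))) (at x)"
    unfolding laurent_eval_def using assms
    by (auto intro!: derivative_eq_intros sum.cong simp: mult_ac)
  then show ?thesis by (auto simp: field_differentiable_def)
qed

definition GL :: "nat \<Rightarrow> laurent mat monoid" where
  "GL m = units_of (ring_mat TYPE(laurent) m ())"

definition burau_gen :: "nat \<Rightarrow> nat \<Rightarrow> laurent mat" where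
  "burau_gen m k = diag_block_mat
    [1\<^sub>m (k - 1), mat_of_rows_list 2 [[1 - laurent_t, 1], [laurent_t, 0]], 1\<^sub>m (m - k - 1)]"

definition burau :: "nat \<Rightarrow> braid_word set \<Rightarrow> laurent mat" where
  "burau m = braid_lift (GL m) (burau_gen m)"

lemma burau_gen_carrier: "k \<in> {1..<m} \<Longrightarrow> burau_gen m k \<in> carrier_mat m m"
  unfolding burau_gen_def carrier_mat_def
  by (auto simp: dim_diag_block_mat mat_of_rows_list_def)

lemma burau_gen_index:
  assumes "k \<in> {1..<m}" "i < m" "j < m"
  shows "burau_gen m k $$ (i, j) =
    (if i = k - 1 then (if j = k - 1 then 1 - laurent_t else if j = k then 1 else 0)
     else if i = k then (if j = k - 1 then laurent_t else 0)
     else if i = j then 1 else 0)"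
proof -
  obtain n r where n: "k = Suc n" "m = Suc (Suc (n + r))"
    using assms(1) by (metis One_nat_def Suc_le_D add_Suc atLeastLessThan_iff less_imp_Suc_add)
  have x: "x < n \<or> x = n \<or> x = Suc n \<or> (\<exists>y. x = n + 2 + y)" for x
    by presburger
  show ?thesis
    using x[of i] x[of j] assms(2,3) unfolding n burau_gen_def
    by (elim disjE exE) (simp_all add: Let_def mat_of_rows_list_def)
qed

lemma burau_gen_mult_index:
  assumes k: "k \<in> {1..<m}" and A: "A \<in> carrier_mat m m" and ij: "i < m" "j < m"
  shows "(burau_gen m k * A) $$ (i, j) =
    (if i = k - 1 then (1 - laurent_t) * A $$ (k - 1, j) + A $$ (k, j)
     else if i = k then laurent_t * A $$ (k - 1, j) else A $$ (i, j))"
proof -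
  have "(burau_gen m k * A) $$ (i, j) = (\<Sum>l\<in>{0..<m}. burau_gen m k $$ (i, l) * A $$ (l, j))"
    using burau_gen_carrier[OF k] A ij by (auto simp: times_mat_def scalar_prod_def)
  also have "\<dots> = (\<Sum>l\<in>{0..<m}.
      (if l = k - 1 then (if i = k - 1 then 1 - laurent_t else if i = k then laurent_t else 0) * A $$ (l, j) else 0)
    + (if l = k then (if i = k - 1 then 1 else 0) * A $$ (l, j) else 0)
    + (if l = i then (if i = k - 1 \<or> i = k then 0 else 1) * A $$ (l, j) else 0))"
    using k ij by (intro sum.cong) (auto simp: burau_gen_index)
  also have "\<dots> = (if i = k - 1 then (1 - laurent_t) * A $$ (k - 1, j) + A $$ (k, j)
     else if i = k then laurent_t * A $$ (k - 1, j) else A $$ (i, j))"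
    using k ij by (auto simp: sum.distrib)
  finally show ?thesis .
qed

definition laurent_t_inv :: laurent where
  "laurent_t_inv = Poly_Mapping.single (- 1) 1"

lemma laurent_t_inv: "laurent_t * laurent_t_inv = 1"
  by (simp add: laurent_t_def laurent_t_inv_def mult_single)

lemma group_GL: "group (GL m)"
  unfolding GL_def by (intro monoid.units_group ring.is_monoid ring_mat)

lemma burau_gen_GL:
  assumes k: "k \<in> {1..<m}"
  shows "burau_gen m k \<in> carrier (GL m)"
proof -
  define B where "B = burau_gen m k"
  define C :: "laurent mat" where "C = mat m m (\<lambda>(i, j).
     if i = k - 1 then (if j = k then laurent_t_inv else 0)
     else if i = k then (if j = k - 1 then 1 else if j = k then (laurent_t - 1) * laurent_t_inv else 0)
     else if i = j then 1 else 0)"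
  have kk: "k - 1 \<noteq> k" "k \<noteq> k - 1" "k - 1 < m" "k < m" using k by auto
  have B: "B \<in> carrier_mat m m" unfolding B_def using k by (rule burau_gen_carrier)
  have C: "C \<in> carrier_mat m m" by (simp add: C_def)
  have Bi: "B $$ (i, j) =
    (if i = k - 1 then (if j = k - 1 then 1 - laurent_t else if j = k then 1 else 0)
     else if i = k then (if j = k - 1 then laurent_t else 0)
     else if i = j then 1 else 0)" if "i < m" "j < m" for i j
    unfolding B_def using k that by (rule burau_gen_index)
  have Ci: "C $$ (i, j) =
     (if i = k - 1 then (if j = k then laurent_t_inv else 0)
     else if i = k then (if j = k - 1 then 1 else if j = k then (laurent_t - 1) * laurent_t_inv else 0)
     else if i = j then 1 else 0)" if "i < m" "j < m" for i j
    using that by (simp add: C_def)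
  have BC: "B * C = 1\<^sub>m m"
  proof (rule eq_matI)
    fix i j assume "i < dim_row (1\<^sub>m m :: laurent mat)" "j < dim_col (1\<^sub>m m :: laurent mat)"
    then have ij: "i < m" "j < m" by auto
    have *: "(1 - laurent_t) * laurent_t_inv + (laurent_t - 1) * laurent_t_inv = 0"
      by (simp add: algebra_simps)
    have "(B * C) $$ (i, j) =
      (if i = k - 1 then (1 - laurent_t) * C $$ (k - 1, j) + C $$ (k, j)
       else if i = k then laurent_t * C $$ (k - 1, j) else C $$ (i, j))"
      unfolding B_def by (rule burau_gen_mult_index[OF k C ij])
    also have "\<dots> = 1\<^sub>m m $$ (i, j)"
      using ij kk k * by (auto simp: Ci laurent_t_inv)
    finally show "(B * C) $$ (i, j) = 1\<^sub>m m $$ (i, j)" .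
  qed (use B C in auto)
  have CB: "C * B = 1\<^sub>m m"
  proof (rule eq_matI)
    fix i j assume "i < dim_row (1\<^sub>m m :: laurent mat)" "j < dim_col (1\<^sub>m m :: laurent mat)"
    then have ij: "i < m" "j < m" by auto
    have inv': "laurent_t_inv * laurent_t = 1"
      using laurent_t_inv by (simp add: mult.commute)
    have *: "(laurent_t - 1) * laurent_t_inv * laurent_t = laurent_t - 1"
      by (simp add: mult.assoc inv')
    have "(C * B) $$ (i, j) = (\<Sum>l\<in>{0..<m}. C $$ (i, l) * B $$ (l, j))"
      using B C ij by (auto simp: times_mat_def scalar_prod_def)
    also have "\<dots> = (\<Sum>l\<in>{0..<m}.
        (if l = k - 1 then (if i = k then 1 else 0) * B $$ (l, j) else 0)
      + (if l = k then (if i = k - 1 then laurent_t_inv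
           else if i = k then (laurent_t - 1) * laurent_t_inv else 0) * B $$ (l, j) else 0)
      + (if l = i then (if i = k - 1 \<or> i = k then 0 else 1) * B $$ (l, j) else 0))"
      using ij kk by (intro sum.cong) (auto simp: Ci)
    also have "\<dots> = (if i = k - 1 then laurent_t_inv * B $$ (k, j)
        else if i = k then B $$ (k - 1, j) + (laurent_t - 1) * laurent_t_inv * B $$ (k, j)
        else B $$ (i, j))"
      using ij kk by (simp add: sum.distrib)
    also have "\<dots> = 1\<^sub>m m $$ (i, j)"
      using ij kk k by (auto simp: Bi inv' *)
    finally show "(C * B) $$ (i, j) = 1\<^sub>m m $$ (i, j)" .
  qed (use B C in auto)
  show ?thesis
    using B C BC CB by (auto simp: GL_def units_of_def Units_def ring_mat_def B_def)
qed

lemma burau_braid_rel: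
  assumes k: "k \<in> {1..<m}" "Suc k \<in> {1..<m}"
  shows "burau_gen m k * (burau_gen m (Suc k) * burau_gen m k) =
    burau_gen m (Suc k) * (burau_gen m k * burau_gen m (Suc k))"
    (is "?L = ?R")
proof (rule eq_matI)
  note [[linarith_neq_limit = 0]]
  note B = burau_gen_carrier[OF k(1)] burau_gen_carrier[OF k(2)]
  note BB = mult_carrier_mat[OF B] mult_carrier_mat[OF B(2) B(1)]
  fix i j assume "i < dim_row ?R" "j < dim_col ?R"
  then have ij: "i < m" "j < m" using B by auto
  obtain n where n: "k = Suc n" using k by (cases k) auto
  have nm: "n < m" "Suc n < m" "Suc (Suc n) < m" using k n by auto
  note simps = burau_gen_mult_index[OF k(1)] burau_gen_mult_index[OF k(2)]
    burau_gen_index[OF k(1)] burau_gen_index[OF k(2)]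
  have cases: "x = n \<or> x = Suc n \<or> x = Suc (Suc n) \<or> x \<noteq> n \<and> x \<noteq> Suc n \<and> x \<noteq> Suc (Suc n)" for x
    by blast
  show "?L $$ (i, j) = ?R $$ (i, j)"
    using cases[of i] cases[of j] ij nm B BB unfolding n
    by (elim disjE conjE)
      (simp_all add: simps[unfolded n] algebra_simps del: index_mult_mat)
qed (use burau_gen_carrier[OF k(1)] burau_gen_carrier[OF k(2)] in auto)

lemma burau_far_rel:
  assumes k: "i \<in> {1..<m}" "j \<in> {1..<m}" "Suc i < j"
  shows "burau_gen m i * burau_gen m j = burau_gen m j * burau_gen m i"
    (is "?L = ?R")
proof (rule eq_matI)
  note [[linarith_neq_limit = 0]]
  note B = burau_gen_carrier[OF k(1)] burau_gen_carrier[OF k(2)]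
  fix r c assume "r < dim_row ?R" "c < dim_col ?R"
  then have rc: "r < m" "c < m" using B by auto
  have *: "i - 1 < m" "i < m" "j - 1 < m" "j < m" "i - 1 \<noteq> i" "j - 1 \<noteq> j"
    "i \<noteq> j" "i - 1 \<noteq> j" "i \<noteq> j - 1" "i - 1 \<noteq> j - 1"
    using k by auto
  show "?L $$ (r, c) = ?R $$ (r, c)"
    unfolding burau_gen_mult_index[OF k(1) B(2) rc] burau_gen_mult_index[OF k(2) B(1) rc]
    by (simp only: burau_gen_index[OF k(1)] burau_gen_index[OF k(2)] rc *)
      (simp add: * *(5-10)[THEN not_sym] del: One_nat_def)
qed (use burau_gen_carrier[OF k(1)] burau_gen_carrier[OF k(2)] in auto)

lemma GL_mult: "A \<otimes>\<^bsub>GL m\<^esub> B = A * B"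
  by (simp add: GL_def units_of_def ring_mat_def)

lemma burau_hom: "burau m \<in> hom (braid_group m) (GL m)"
  unfolding burau_def
  by (rule braid_lift_hom; (unfold GL_mult)?;
      (rule group_GL burau_gen_GL burau_braid_rel burau_far_rel)?; assumption)

lemma burau_braid_gen: "k \<in> {1..<m} \<Longrightarrow> burau m (braid_gen m k) = burau_gen m k"
  unfolding burau_def
  by (rule braid_lift_gen; (unfold GL_mult)?;
      (rule group_GL burau_gen_GL burau_braid_rel burau_far_rel)?; assumption)


section \<open>The crossing matrix\<close>

text \<open>The signed number of crossings in the diagram \<open>w\<close> at which the strand with upper endpoint at
  position \<open>p\<close> is over the one with upper endpoint at position \<open>q\<close>: below the first letter these
  strands continue from the positions \<open>transpose k (Suc k) p\<close> and \<open>transpose k (Suc k) q\<close>.\<close>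

fun signed_over :: "braid_word \<Rightarrow> nat \<Rightarrow> nat \<Rightarrow> int" where
  "signed_over [] p q = 0"
| "signed_over ((k, s) # w) p q =
    (if s \<and> p = Suc k \<and> q = k then 1
     else if \<not> s \<and> p = k \<and> q = Suc k then - 1
     else 0)
    + signed_over w (Transposition.transpose k (Suc k) p) (Transposition.transpose k (Suc k) q)"

text \<open>Matrix rows and columns are indexed from 0, strands from 1.\<close>

definition word_crossing_matrix :: "nat \<Rightarrow> braid_word \<Rightarrow> int mat" where
  "word_crossing_matrix m w =
    mat m m (\<lambda>(i, j). if i = j then 0 else signed_over w (Suc i) (Suc j))"

text \<open>The common value on all words representing a braid (see \<open>crossing_matrix_word\<close>).\<close>

definition crossing_matrix :: "nat \<Rightarrow> braid_word set \<Rightarrow> int mat" where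
  "crossing_matrix m b = the_elem (word_crossing_matrix m ` b)"

text \<open>The lower position of the strand with upper position \<open>p\<close>.\<close>

definition lower_pos :: "braid_word \<Rightarrow> nat \<Rightarrow> nat" where
  "lower_pos w p = foldl (\<lambda>q (k, s). Transposition.transpose k (Suc k) q) p w"

lemma signed_over_append:
  "signed_over (u @ v) p q = signed_over u p q + signed_over v (lower_pos u p) (lower_pos u q)"
  by (induction u arbitrary: p q) (auto simp: lower_pos_def)

lemma lower_pos_append: "lower_pos (u @ v) p = lower_pos v (lower_pos u p)"
  by (simp add: lower_pos_def)

lemma signed_over_equiv:
  "braid_equiv m u v \<Longrightarrow> lower_pos u = lower_pos v \<and> signed_over u = signed_over v"
proof (induction rule: braid_equiv.induct)
  case (be_append u v u' v')
  then show ?case by (auto simp: fun_eq_iff lower_pos_append signed_over_append)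
qed (auto simp: fun_eq_iff lower_pos_def Transposition.transpose_def)

lemma crossing_matrix_word:
  assumes "b \<in> carrier (braid_group m)" "w \<in> b"
  shows "crossing_matrix m b = word_crossing_matrix m w"
proof -
  obtain u where u: "b = braid_rel m `` {u}" using assms(1) by (rule braid_group_carrierE)
  have "word_crossing_matrix m v = word_crossing_matrix m w" if "v \<in> b" for v
  proof -
    have "braid_equiv m v w"
      using that assms(2) by (auto simp: u braid_rel_def intro: braid_equiv.be_sym braid_equiv.be_trans)
    then have "signed_over v = signed_over w" using signed_over_equiv by blast
    then show ?thesis by (simp only: word_crossing_matrix_def)
  qed
  then have "word_crossing_matrix m ` b = (\<lambda>_. word_crossing_matrix m w) ` b"
    by (rule image_cong[OF refl])
  also have "\<dots> = {word_crossing_matrix m w}"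
    using assms(2) by blast
  finally have "word_crossing_matrix m ` b = {word_crossing_matrix m w}" .
  then show ?thesis by (simp add: crossing_matrix_def)
qed

lemma word_val_lower_pos:
  assumes "w \<in> braid_words m"
  shows "word_val (sym_group m) (\<lambda>k. Transposition.transpose k (Suc k)) w (lower_pos w p) = p"
  using assms
proof (induction w arbitrary: p)
  case Nil
  then show ?case by (simp add: word_val_def lower_pos_def sym_group_one)
next
  case (Cons x w)
  obtain k s where x: "x = (k, s)" by force
  have w: "w \<in> braid_words m" and k: "k \<in> {1..<m}"
    using Cons.prems by (auto simp: braid_words_def x)
  let ?t = "Transposition.transpose k (Suc k)"
  have "inv\<^bsub>sym_group m\<^esub> ?t = ?t"
    using transpose_sym_group[OF k]
    by (intro group.inv_equality[OF sym_group_is_group]) (auto simp: sym_group_mult sym_group_one)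
  then show ?case
    using Cons.IH[OF w, of "?t p"] by (simp add: word_val_def lower_pos_def x sym_group_mult)
qed

lemma pure_braid_iff:
  assumes "b \<in> carrier (braid_group m)" "w \<in> b"
  shows "b \<in> pure_braids m \<longleftrightarrow> (\<forall>p \<in> {1..m}. lower_pos w p = p)"
proof -
  let ?v = "word_val (sym_group m) (\<lambda>k. Transposition.transpose k (Suc k)) w"
  obtain u where u: "b = braid_rel m `` {u}" using assms(1) by (rule braid_group_carrierE)
  have w: "w \<in> braid_words m"
    using assms(2) braid_equiv_words by (auto simp: u braid_rel_def)
  have bw: "b = braid_rel m `` {w}"
    using assms(2) equiv_class_eq[OF equiv_braid_rel] by (auto simp: u)
  have v: "braid_perm m b = ?v"
    unfolding bw braid_perm_def by (rule braid_lift_class) (use transpose_rels w in auto)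
  have perm: "?v permutes {1..m}"
    using hom_in_carrier[OF braid_perm_hom assms(1)] by (simp add: v sym_group_carrier)
  have "?v = id \<longleftrightarrow> (\<forall>p \<in> {1..m}. lower_pos w p = p)"
  proof
    assume "?v = id"
    then show "\<forall>p \<in> {1..m}. lower_pos w p = p" using word_val_lower_pos[OF w] by simp
  next
    assume *: "\<forall>p \<in> {1..m}. lower_pos w p = p"
    show "?v = id"
    proof
      fix p
      show "?v p = id p"
        using * word_val_lower_pos[OF w, of p] perm by (cases "p \<in> {1..m}") (auto simp: permutes_def)
    qed
  qed
  then show ?thesis
    using assms(1) by (simp add: pure_braids_def kernel_def v sym_group_one)
qed

end

theory Submission
  imports Defs
begin

text \<open>At \<open>t = 1\<close> the Burau matrix of a word \<open>w\<close> is the permutation matrix of \<open>lower_pos w\<close>.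
  Differentiating the product rule for one letter at \<open>t = 1\<close> shows, by induction on the word, that
  the entry in row \<open>p\<close> and column \<open>lower_pos w q\<close> has derivative
  \<open>- signed_over w q p\<close>, with the roles of \<open>p\<close> and \<open>q\<close> exchanged. For a pure braid the exchange
  is harmless: \<open>signed_over w p q - signed_over w q p\<close> counts the net passages of the strand
  \<open>p\<close> from the right to the left of the strand \<open>q\<close>, so it vanishes.\<close>

text \<open>Lets two polynomials and their sum be evaluated over one index set, although
  cancellation may shrink the keys of the sum.\<close>

lemma laurent_eval_superset:
  assumes "finite S" "Poly_Mapping.keys p \<subseteq> S"
  shows "laurent_eval p x = (\<Sum>k\<in>S. of_int (Poly_Mapping.lookup p k) * x powi k)"
  unfolding laurent_eval_def
  by (rule sum.mono_neutral_left) (use assms in \<open>auto simp: in_keys_iff\<close>)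

lemma laurent_eval_add: "laurent_eval (p + q) x = laurent_eval p x + laurent_eval q x"
proof -
  let ?S = "Poly_Mapping.keys p \<union> Poly_Mapping.keys q"
  have "Poly_Mapping.keys (p + q) \<subseteq> ?S" by (rule Poly_Mapping.keys_add)
  then show ?thesis
    by (simp add: laurent_eval_superset[of ?S] lookup_add sum.distrib distrib_right)
qed

lemma laurent_eval_diff: "laurent_eval (p - q) x = laurent_eval p x - laurent_eval q x"
  using laurent_eval_add[of "p - q" q x] by simp

lemma laurent_eval_single: "laurent_eval (Poly_Mapping.single k c) x = of_int c * x powi k"
  by (cases "c = 0") (simp_all add: laurent_eval_def)

lemma laurent_eval_zero: "laurent_eval 0 x = 0"
  by (simp add: laurent_eval_def)

text \<open>The entries of \<open>burau_gen\<close> are 0, 1, t and 1 - t, so this rule and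
  additivity evaluate every product with a generator. It fails at 0 for
  \<open>p = laurent_t_inv\<close>, as \<open>0 powi 0 = 1\<close>.\<close>

lemma laurent_eval_t_mult:
  assumes "x \<noteq> 0"
  shows "laurent_eval (laurent_t * p) x = x * laurent_eval p x"
proof (induction p rule: update_induct)
  case const
  then show ?case by (simp add: laurent_eval_zero)
next
  case (update f k c)
  have "Poly_Mapping.update k c f = Poly_Mapping.single k c + f"
    using update.hyps
    by (intro poly_mapping_eqI) (auto simp: lookup_update lookup_add lookup_single in_keys_iff)
  then show ?case
    using update.IH assms
    by (simp add: distrib_left laurent_eval_add laurent_t_def mult_single laurent_eval_single
        power_int_add)
qed

lemma has_deriv_laurent_eval:
  "x \<noteq> 0 \<Longrightarrow> (laurent_eval p has_field_derivative deriv (laurent_eval p) x) (at x)"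
  using laurent_eval_differentiable by (simp add: DERIV_deriv_iff_field_differentiable)

lemma deriv_laurent_eval_add:
  "x \<noteq> 0 \<Longrightarrow> deriv (laurent_eval (p + q)) x = deriv (laurent_eval p) x + deriv (laurent_eval q) x"
  by (rule DERIV_imp_deriv)
    (auto simp: laurent_eval_add[abs_def] intro!: derivative_intros has_deriv_laurent_eval)

lemma deriv_laurent_eval_diff:
  "x \<noteq> 0 \<Longrightarrow> deriv (laurent_eval (p - q)) x = deriv (laurent_eval p) x - deriv (laurent_eval q) x"
  by (rule DERIV_imp_deriv)
    (auto simp: laurent_eval_diff[abs_def] intro!: derivative_intros has_deriv_laurent_eval)

lemma deriv_laurent_eval_t_mult:
  assumes "x \<noteq> 0"
  shows "deriv (laurent_eval (laurent_t * p)) x = laurent_eval p x + x * deriv (laurent_eval p) x"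
proof (rule DERIV_imp_deriv)
  have "((\<lambda>y. y * laurent_eval p y) has_field_derivative
      laurent_eval p x + x * deriv (laurent_eval p) x) (at x)"
    by (auto intro!: derivative_eq_intros has_deriv_laurent_eval assms)
  then show "(laurent_eval (laurent_t * p) has_field_derivative
      laurent_eval p x + x * deriv (laurent_eval p) x) (at x)"
    \<comment> \<open>The two functions are known to agree only away from 0, which is enough near
      \<open>x\<close>.\<close>
    by (rule has_field_derivative_transform_within_open[where S = "- {0}"])
      (use assms in \<open>auto simp: laurent_eval_t_mult\<close>)
qed

lemmas laurent_at_one_simps =
  laurent_eval_add laurent_eval_diff laurent_eval_t_mult[of 1, simplified]
  deriv_laurent_eval_add[of 1, simplified] deriv_laurent_eval_diff[of 1, simplified]
  deriv_laurent_eval_t_mult[of 1, simplified]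

abbreviation burau_word :: "nat \<Rightarrow> braid_word \<Rightarrow> laurent mat" where
  "burau_word m \<equiv> word_val (GL m) (burau_gen m)"

lemma burau_class: "w \<in> braid_words m \<Longrightarrow> burau m (braid_rel m `` {w}) = burau_word m w"
  unfolding burau_def
  by (rule braid_lift_class; (unfold GL_mult)?;
      (rule group_GL burau_gen_GL burau_braid_rel burau_far_rel)?; assumption)

lemma burau_word_GL: "w \<in> braid_words m \<Longrightarrow> burau_word m w \<in> carrier (GL m)"
  by (rule word_val_closed[where m = m]; (unfold GL_mult)?;
      (rule group_GL burau_gen_GL burau_braid_rel burau_far_rel)?; assumption)

lemma GL_carrier_mat: "A \<in> carrier (GL m) \<Longrightarrow> A \<in> carrier_mat m m"
  by (auto simp: GL_def units_of_def Units_def ring_mat_def)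

lemma burau_word_Cons_True:
  "burau_word m ((k, True) # w) = burau_gen m k * burau_word m w"
  by (simp add: word_val_def GL_mult)

text \<open>Moving the inverse to the other side lets the row formula for a positive letter serve
  both signs.\<close>

lemma burau_word_Cons_False:
  assumes "k \<in> {1..<m}" "w \<in> braid_words m"
  shows "burau_gen m k * burau_word m ((k, False) # w) = burau_word m w"
proof -
  interpret group "GL m" by (rule group_GL)
  let ?g = "burau_gen m k"
  have "?g \<otimes>\<^bsub>GL m\<^esub> (inv\<^bsub>GL m\<^esub> ?g \<otimes>\<^bsub>GL m\<^esub> burau_word m w) = burau_word m w"
    using burau_gen_GL[OF assms(1)] burau_word_GL[OF assms(2)]
    by (simp add: m_assoc[symmetric])
  then show ?thesis by (simp add: word_val_def GL_mult)
qed

text \<open>The strands \<open>p\<close> are numbered from 1, the column \<open>c\<close> is a matrix index counted from 0.\<close>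

lemma burau_gen_mult_at_one:
  assumes k: "k \<in> {1..<m}" and A: "A \<in> carrier_mat m m" and p: "p \<in> {1..m}" and c: "c < m"
  shows "laurent_eval ((burau_gen m k * A) $$ (p - 1, c)) 1 =
      laurent_eval (A $$ (Transposition.transpose k (Suc k) p - 1, c)) 1"
    and "deriv (laurent_eval ((burau_gen m k * A) $$ (p - 1, c))) 1 =
      deriv (laurent_eval (A $$ (Transposition.transpose k (Suc k) p - 1, c))) 1
      + (if p = k then - laurent_eval (A $$ (k - 1, c)) 1
         else if p = Suc k then laurent_eval (A $$ (k - 1, c)) 1 else 0)"
proof -
  have "p - 1 < m" using p by auto
  \<comment> \<open>For strand \<open>k\<close> the row is (1 - t) times row \<open>k - 1\<close> of
    \<open>A\<close> plus row \<open>k\<close>; for strand \<open>Suc k\<close> it is t times row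
    \<open>k - 1\<close>. The corrections come from differentiating the factors 1 - t and t.\<close>
  note * = burau_gen_mult_index[OF k A this c]
  have "p = k \<or> p = Suc k \<or> p \<noteq> k \<and> p \<noteq> Suc k" by auto
  then show "laurent_eval ((burau_gen m k * A) $$ (p - 1, c)) 1 =
      laurent_eval (A $$ (Transposition.transpose k (Suc k) p - 1, c)) 1"
    and "deriv (laurent_eval ((burau_gen m k * A) $$ (p - 1, c))) 1 =
      deriv (laurent_eval (A $$ (Transposition.transpose k (Suc k) p - 1, c))) 1
      + (if p = k then - laurent_eval (A $$ (k - 1, c)) 1
         else if p = Suc k then laurent_eval (A $$ (k - 1, c)) 1 else 0)"
    unfolding * using k p
    by (auto simp: laurent_at_one_simps left_diff_distrib Transposition.transpose_def)
qed

lemma transpose_mem_strands: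
  "k \<in> {1..<m} \<Longrightarrow> p \<in> {1..m} \<Longrightarrow> Transposition.transpose k (Suc k) p \<in> {1..m}"
  by (auto simp: Transposition.transpose_def)

lemma lower_pos_Cons:
  "lower_pos ((k, s) # w) p = lower_pos w (Transposition.transpose k (Suc k) p)"
  by (simp add: lower_pos_def)

lemma lower_pos_mem_strands:
  "w \<in> braid_words m \<Longrightarrow> p \<in> {1..m} \<Longrightarrow> lower_pos w p \<in> {1..m}"
proof (induction w arbitrary: p)
  case Nil
  then show ?case by (simp add: lower_pos_def)
next
  case (Cons x w)
  obtain k s where x: "x = (k, s)" by force
  show ?case
    using Cons.IH[of "Transposition.transpose k (Suc k) p"] Cons.prems
      transpose_mem_strands[of k m p]
    by (simp add: x lower_pos_Cons braid_words_def)
qed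

text \<open>Values and derivatives share one induction: the correction that a letter adds to a
  derivative is, up to sign, a value at 1.\<close>

lemma burau_word_at_one:
  assumes "w \<in> braid_words m" "p \<in> {1..m}" "q \<in> {1..m}"
  shows "laurent_eval (burau_word m w $$ (p - 1, lower_pos w q - 1)) 1 = (if p = q then 1 else 0)
    \<and> (p \<noteq> q \<longrightarrow> deriv (laurent_eval (burau_word m w $$ (p - 1, lower_pos w q - 1))) 1
          = - real_of_int (signed_over w q p))"
  using assms
proof (induction w arbitrary: p q)
  case Nil
  have 0: "burau_word m [] = 1\<^sub>m m"
    by (simp add: word_val_def GL_def units_of_def ring_mat_def)
  have ev: "laurent_eval 1 1 = 1"
    by (simp add: laurent_eval_single flip: single_one)
  have "deriv (laurent_eval 0) 1 = 0"
    by (simp add: laurent_eval_zero[abs_def])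
  then show ?case
    using Nil.prems by (auto simp: 0 ev laurent_eval_zero lower_pos_def)
next
  case (Cons x w)
  obtain k s where x: "x = (k, s)" by force
  have w: "w \<in> braid_words m" and k: "k \<in> {1..<m}"
    using Cons.prems by (auto simp: braid_words_def x)
  let ?t = "Transposition.transpose k (Suc k)"
  note t = transpose_mem_strands[OF k]
  \<comment> \<open>Prepending a letter keeps the lower endpoint of strand \<open>q\<close>, hence
    the column; only rows change.\<close>
  define c where "c = lower_pos w (?t q) - 1"
  have c: "c < m"
    using lower_pos_mem_strands[OF w t[OF Cons.prems(3)]] by (auto simp: c_def)
  let ?A = "burau_word m w" and ?B = "burau_word m (x # w)"
  have A: "?A \<in> carrier_mat m m" and B: "?B \<in> carrier_mat m m"
    by (rule GL_carrier_mat, rule burau_word_GL, fact)+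
  have IH: "laurent_eval (?A $$ (r - 1, c)) 1 = (if r = ?t q then 1 else 0)"
      "r \<noteq> ?t q \<Longrightarrow> deriv (laurent_eval (?A $$ (r - 1, c))) 1
          = - real_of_int (signed_over w (?t q) r)"
    if "r \<in> {1..m}" for r
    using Cons.IH[OF w that t[OF Cons.prems(3)]] by (auto simp: c_def)
  have kk: "k \<in> {1..m}" using k by auto
  have col: "lower_pos (x # w) q - 1 = c" by (simp add: c_def x lower_pos_Cons)
  have inj: "?t p = ?t q \<longleftrightarrow> p = q" for p q
    by (rule inj_eq[OF inj_transpose])
  \<comment> \<open>The value in row \<open>k - 1\<close> of \<open>?A\<close> is 1 exactly when
    \<open>q\<close> is the strand passing over at a positive letter.\<close>
  have tk: "k = ?t q \<longleftrightarrow> q = Suc k"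
    by (auto simp: Transposition.transpose_def)
  show ?case
  proof (cases s)
    case True
    have BA: "?B = burau_gen m k * ?A" by (simp add: x True burau_word_Cons_True)
    note step = burau_gen_mult_at_one[OF k A Cons.prems(2) c, folded BA]
    have "laurent_eval (?B $$ (p - 1, c)) 1 = (if p = q then 1 else 0)"
      unfolding step(1) IH(1)[OF t[OF Cons.prems(2)]] inj ..
    moreover have "deriv (laurent_eval (?B $$ (p - 1, c))) 1
        = - real_of_int (signed_over (x # w) q p)" if "p \<noteq> q"
    proof -
      have "?t p \<noteq> ?t q" using that by (simp only: inj simp_thms)
      from IH(2)[OF t[OF Cons.prems(2)] this] show ?thesis
        unfolding step(2) IH(1)[OF kk] tk unfolding x signed_over.simps
        using that True by simp
    qed
    ultimately show ?thesis unfolding col by blast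
  next
    case False
    have AB: "?A = burau_gen m k * ?B" using burau_word_Cons_False[OF k w] by (simp add: x False)
    \<comment> \<open>Taken for strand \<open>?t r\<close>, so that involutivity of
      \<open>?t\<close> returns the row of \<open>?B\<close> for strand \<open>r\<close>. The
      correction now involves \<open>?B\<close> itself, so its values \<open>e\<close> come
      first.\<close>
    note step = burau_gen_mult_at_one[OF k B t c, folded AB]
    have e: "laurent_eval (?B $$ (r - 1, c)) 1 = (if r = q then 1 else 0)" if "r \<in> {1..m}" for r
      using step(1)[OF that] unfolding IH(1)[OF t[OF that]] inj transpose_involutory by (rule sym)
    moreover have "deriv (laurent_eval (?B $$ (p - 1, c))) 1
        = - real_of_int (signed_over (x # w) q p)" if "p \<noteq> q"
    proof -
      have "?t p \<noteq> ?t q" using that by (simp only: inj simp_thms)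
      moreover have "?t p = k \<longleftrightarrow> p = Suc k" "?t p = Suc k \<longleftrightarrow> p = k"
        by (auto simp: Transposition.transpose_def)
      ultimately show ?thesis
        using step(2)[OF Cons.prems(2)] IH(2)[OF t[OF Cons.prems(2)]] that False
        unfolding e[OF kk] transpose_involutory unfolding x signed_over.simps
        by (auto split: if_splits)
    qed
    ultimately show ?thesis unfolding col using Cons.prems(2) by blast
  qed
qed

text \<open>The over strand moves left at a positive letter and right at a negative one. So each
  crossing of the two strands adds 1 to the difference if \<open>p\<close> moves left past
  \<open>q\<close>, and -1 otherwise; the sum telescopes to the initial and final orders.\<close>

lemma signed_over_swap:
  "p \<noteq> q \<Longrightarrow> signed_over w p q - signed_over w q p
    = of_bool (q < p) - of_bool (lower_pos w q < lower_pos w p)"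
proof (induction w arbitrary: p q)
  case Nil
  then show ?case by (simp add: lower_pos_def)
next
  case (Cons x w)
  obtain k s where x: "x = (k, s)" by force
  let ?t = "Transposition.transpose k (Suc k)"
  have "?t p \<noteq> ?t q" using Cons.prems by (auto simp: inj_eq[OF inj_transpose])
  from Cons.IH[OF this] Cons.prems show ?case
    by (cases s) (auto simp: x lower_pos_Cons Transposition.transpose_def split: if_splits)
qed

theorem corollary1:
  fixes m i j :: nat and b :: "braid_word set"
  assumes "m \<ge> 1"
    and "b \<in> pure_braids m"
    and "i < m" and "j < m"
  shows "real_of_int (crossing_matrix m b $$ (i, j)) =
    (if i = j then 0 else - deriv (laurent_eval (burau m b $$ (i, j))) 1)"
proof -
  have b: "b \<in> carrier (braid_group m)"
    using assms(2) by (simp add: pure_braids_def kernel_def)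
  then obtain w where w: "w \<in> braid_words m" "b = braid_rel m `` {w}"
    by (rule braid_group_carrierE)
  have wb: "w \<in> b"
    using w by (auto simp: braid_rel_def intro: braid_equiv.be_refl)
  have ij: "Suc i \<in> {1..m}" "Suc j \<in> {1..m}" using assms by auto
  \<comment> \<open>Purity enters twice: the column \<open>lower_pos w (Suc j) - 1\<close> becomes
    \<open>j\<close>, and the two order terms of \<open>signed_over_swap\<close> cancel.\<close>
  have low: "lower_pos w (Suc i) = Suc i" "lower_pos w (Suc j) = Suc j"
    using pure_braid_iff[OF b wb] assms(2) ij by blast+
  have C: "crossing_matrix m b $$ (i, j) = (if i = j then 0 else signed_over w (Suc i) (Suc j))"
    using crossing_matrix_word[OF b wb] assms by (simp add: word_crossing_matrix_def)
  show ?thesis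
    using burau_word_at_one[OF w(1) ij] signed_over_swap[of "Suc i" "Suc j" w]
    by (auto simp: C low burau_class[OF w(1), folded w(2)])
qed

end
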